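(* There exist probability density functions $\{f_n\}$ and $f$ on $[0,1]$, with $H(f)$ finite, and a sequence of real numbers $\alpha_n>1$ with $\alpha_n\downarrow1$, such that: (i) $f_n\to f$ almost everywhere (hence in Lebesgue measure); (ii) $\sup_n\int_0^1 f_n\,(\lvert\log f_n\rvert)^{\alpha_n}\,dx<\infty$; (iii) $H(f_n)\not\to H(f)$.
   Context: A probability density function (pdf) on $[0,1]$ is a measurable $f:[0,1]\to[0,\infty)$ with $\int_0^1 f\,dx=1$. The differential entropy is $H(f)=-\int_0^1 f\log f\,dx$, with natural logarithm and the convention $0\log0=0$ (likewise $f\lvert\log f\rvert^{\alpha}=0$ where $f=0$). "$H(f)$ finite" means $f\log f\in L^1([0,1])$. The notation $\alpha_n\downarrow1$ means that $(\alpha_n)$ is a decreasing sequence converging to $1$. *)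

theory Defs
  imports "HOL-Analysis.Analysis"
begin

abbreviation unit_leb :: "real measure" where
  "unit_leb \<equiv> lebesgue_on {0..1}"

text \<open>
  Functions on \<open>[0,1]\<close> are represented by functions on \<open>real\<close> whose values outside
  \<open>[0,1]\<close> are irrelevant.
\<close>

definition unit_pdf :: "(real \<Rightarrow> real) \<Rightarrow> bool" where
  "unit_pdf f \<longleftrightarrow>
     f \<in> borel_measurable unit_leb \<and>
     (\<forall>x\<in>{0..1}. 0 \<le> f x) \<and>
     (\<integral>\<^sup>+x. ennreal (f x) \<partial>unit_leb) = 1"

text \<open>
  Where \<open>f x = 0\<close> the integrand \<open>f x * ln (f x)\<close> is \<open>0\<close>, in line with the convention
  \<open>0 log 0 = 0\<close>. The Bochner integral is \<open>0\<close> by default if the integrand is not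
  integrable, so the value of \<open>diff_entropy f\<close> is meaningful only under \<open>finite_entropy f\<close>.
\<close>

definition diff_entropy :: "(real \<Rightarrow> real) \<Rightarrow> real" where
  "diff_entropy f = - (\<integral>x. f x * ln (f x) \<partial>unit_leb)"

definition finite_entropy :: "(real \<Rightarrow> real) \<Rightarrow> bool" where
  "finite_entropy f \<longleftrightarrow> integrable unit_leb (\<lambda>x. f x * ln (f x))"

text \<open>
  An extended nonnegative integral, so that a bound on it does imply integrability.
  For a density and \<open>\<alpha> \<ge> 1\<close>, a finite value entails \<open>finite_entropy f\<close>,
  because \<open>\<bar>ln y\<bar> \<le> 1 + \<bar>ln y\<bar> powr \<alpha>\<close>.
\<close>

definition log_moment :: "real \<Rightarrow> (real \<Rightarrow> real) \<Rightarrow> ennreal" where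
  "log_moment \<alpha> f = (\<integral>\<^sup>+x. ennreal (f x * \<bar>ln (f x)\<bar> powr \<alpha>) \<partial>unit_leb)"

definition tendsto_in_measure :: "(nat \<Rightarrow> real \<Rightarrow> real) \<Rightarrow> (real \<Rightarrow> real) \<Rightarrow> bool" where
  "tendsto_in_measure F f \<longleftrightarrow>
     (\<forall>\<epsilon>>0. (\<lambda>n. measure unit_leb {x\<in>{0..1}. \<epsilon> < \<bar>F n x - f x\<bar>}) \<longlonglongrightarrow> 0)"

end

theory Submission
  imports Defs "HOL-Real_Asymp.Real_Asymp"
begin

text \<open>
  The limit is the uniform density, of entropy \<open>0\<close>. For \<open>m \<ge> 2\<close> put mass \<open>1 / m\<close> at height \<open>exp m\<close>
  on a short interval at \<open>0\<close> and spread the rest evenly. The spike vanishes in the limit but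
  always contributes \<open>(1 / m) * ln (exp m) = 1\<close> to the integral of \<open>f ln f\<close>. With \<open>\<alpha> = 1 + 1 / m\<close>
  its log-moment is \<open>(1 / m) * m powr \<alpha> = m powr (1 / m) \<le> 2\<close>, so the exponents tend to \<open>1\<close> too fast
  for the bounded moments to force uniform integrability.
\<close>

text \<open>One family covers everything needed: the spiked densities, with spike \<open>a\<close>
  on \<open>{0..e}\<close>, and the uniform density, as \<open>step_fun 0 1 1\<close>.\<close>

definition step_fun :: "real \<Rightarrow> real \<Rightarrow> real \<Rightarrow> real \<Rightarrow> real" where
  "step_fun e a b x = (if x \<le> e then a else b)"

text \<open>Keeping \<open>g\<close> arbitrary makes mass, entropy and log-moment instances of one
  computation: \<open>g y\<close> is \<open>y\<close>, \<open>y * ln y\<close> or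
  \<open>y * \<bar>ln y\<bar> powr \<alpha>\<close>.\<close>

lemma has_bochner_integral_step_fun:
  fixes g :: "real \<Rightarrow> real"
  assumes "0 \<le> e" "e \<le> 1"
  shows "has_bochner_integral unit_leb (\<lambda>x. g (step_fun e a b x)) (e * g a + (1 - e) * g b)"
proof -
  have 1: "has_bochner_integral unit_leb (indicator {0..e}) (measure unit_leb {0..e})"
    using assms by (intro has_bochner_integral_real_indicator)
      (auto simp: sets_restrict_space_iff emeasure_restrict_space)
  have 2: "has_bochner_integral unit_leb (indicator {e<..1}) (measure unit_leb {e<..1})"
    using assms by (intro has_bochner_integral_real_indicator)
      (auto simp: sets_restrict_space_iff emeasure_restrict_space subset_eq)
  have "measure unit_leb {0..e} = e" "measure unit_leb {e<..1} = 1 - e"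
    using assms by (auto simp: measure_restrict_space subset_eq)
  with 1 2 have "has_bochner_integral unit_leb
      (\<lambda>x. indicator {0..e} x * g a + indicator {e<..1} x * g b) (e * g a + (1 - e) * g b)"
    by (intro has_bochner_integral_add has_bochner_integral_mult_left) auto
  then show ?thesis
    by (rule has_bochner_integral_cong[THEN iffD1, rotated -1])
      (auto simp: step_fun_def indicator_def)
qed

lemma nn_integral_step_fun:
  fixes g :: "real \<Rightarrow> real"
  assumes "0 \<le> e" "e \<le> 1" "0 \<le> g a" "0 \<le> g b"
  shows "(\<integral>\<^sup>+x. ennreal (g (step_fun e a b x)) \<partial>unit_leb) = ennreal (e * g a + (1 - e) * g b)"
  using has_bochner_integral_step_fun[OF assms(1,2), of g a b] assms(3,4)
  by (subst nn_integral_eq_integral)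
    (auto simp: has_bochner_integral_iff step_fun_def)

lemma unit_pdf_step_fun:
  assumes "0 \<le> e" "e \<le> 1" "0 \<le> a" "0 \<le> b" "e * a + (1 - e) * b = 1"
  shows "unit_pdf (step_fun e a b)"
proof -
  have "step_fun e a b \<in> borel_measurable unit_leb"
    using has_bochner_integral_step_fun[OF assms(1,2), of "\<lambda>y. y" a b]
    by (auto simp: has_bochner_integral_iff)
  then show ?thesis
    using assms nn_integral_step_fun[of e "\<lambda>y. y" a b]
    by (auto simp: unit_pdf_def step_fun_def)
qed

lemma diff_entropy_step_fun:
  assumes "0 \<le> e" "e \<le> 1"
  shows "diff_entropy (step_fun e a b) = - (e * (a * ln a) + (1 - e) * (b * ln b))"
  using has_bochner_integral_step_fun[OF assms, of "\<lambda>y. y * ln y" a b]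
  by (simp add: diff_entropy_def has_bochner_integral_iff)

lemma log_moment_step_fun:
  assumes "0 \<le> e" "e \<le> 1" "0 \<le> a" "0 \<le> b"
  shows "log_moment \<alpha> (step_fun e a b) =
    ennreal (e * (a * \<bar>ln a\<bar> powr \<alpha>) + (1 - e) * (b * \<bar>ln b\<bar> powr \<alpha>))"
  using nn_integral_step_fun[OF assms(1,2), of "\<lambda>y. y * \<bar>ln y\<bar> powr \<alpha>" a b] assms(3,4)
  by (simp add: log_moment_def)

text \<open>Each fixed \<open>x > 0\<close> eventually lies to the right of the spike, so the
  heights \<open>a n\<close> may grow without bound.\<close>

lemma step_fun_tendsto:
  assumes "e \<longlonglongrightarrow> 0" "b \<longlonglongrightarrow> c" "0 < x"
  shows "(\<lambda>n. step_fun (e n) (a n) (b n) x) \<longlonglongrightarrow> c"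
proof -
  have "eventually (\<lambda>n. e n < x) sequentially"
    using assms by (intro order_tendstoD)
  then have "eventually (\<lambda>n. b n = step_fun (e n) (a n) (b n) x) sequentially"
    by eventually_elim (simp add: step_fun_def)
  with assms(2) show ?thesis
    by (rule Lim_transform_eventually)
qed

text \<open>Once \<open>b n\<close> is within \<epsilon> of \<open>c\<close>, only points of the
  spike interval can deviate by more than \<epsilon>, and that interval has measure
  \<open>e n\<close>.\<close>

lemma step_fun_tendsto_in_measure:
  assumes "e \<longlonglongrightarrow> 0" "b \<longlonglongrightarrow> c" "\<And>n. 0 \<le> e n" "\<And>n. e n \<le> 1"
  shows "tendsto_in_measure (\<lambda>n. step_fun (e n) (a n) (b n)) (\<lambda>_. c)"
  unfolding tendsto_in_measure_def
proof (intro allI impI)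
  fix \<epsilon> :: real assume "0 < \<epsilon>"
  then have "eventually (\<lambda>n. \<bar>b n - c\<bar> < \<epsilon>) sequentially"
    using assms(2) by (auto simp: tendsto_iff dist_real_def)
  then have "eventually (\<lambda>n. norm (measure unit_leb
      {x \<in> {0..1}. \<epsilon> < \<bar>step_fun (e n) (a n) (b n) x - c\<bar>}) \<le> e n) sequentially"
  proof eventually_elim
    case (elim n)
    have "measure unit_leb {x \<in> {0..1}. \<epsilon> < \<bar>step_fun (e n) (a n) (b n) x - c\<bar>}
        \<le> measure unit_leb {0..e n}"
      using elim assms(3,4)[of n]
      by (intro measure_mono_fmeasurable fmeasurableI)
        (auto simp: step_fun_def sets_restrict_space_iff emeasure_restrict_space split: if_splits
          intro!: sets.sets_Collect)
    also have "\<dots> = e n"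
      using assms(3,4)[of n] by (auto simp: measure_restrict_space)
    finally show ?case by simp
  qed
  then show "(\<lambda>n. measure unit_leb
      {x \<in> {0..1}. \<epsilon> < \<bar>step_fun (e n) (a n) (b n) x - c\<bar>}) \<longlonglongrightarrow> 0"
    using assms(1) by (rule Lim_null_comparison)
qed

text \<open>This is the \<open>m\<close>-th root of \<open>m \<le> 2 powr m\<close>; it bounds the
  log-moment of the spike.\<close>

lemma powr_inverse_le_2:
  fixes m :: nat
  assumes "0 < m"
  shows "real m powr (1 / real m) \<le> 2"
proof -
  have "real m \<le> 2 powr real m"
    by (metis less_imp_le of_nat_less_two_power powr_realpow zero_less_numeral)
  then have "real m powr (1 / real m) \<le> (2 powr real m) powr (1 / real m)"
    by (intro powr_mono2) auto
  also have "\<dots> = 2"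
    using assms by (simp add: powr_powr)
  finally show ?thesis .
qed

theorem theorem15:
  shows "\<exists>(F :: nat \<Rightarrow> real \<Rightarrow> real) (f :: real \<Rightarrow> real) (\<alpha> :: nat \<Rightarrow> real).
    (\<forall>n. unit_pdf (F n)) \<and> unit_pdf f \<and> finite_entropy f \<and>
    (\<forall>n. 1 < \<alpha> n) \<and> decseq \<alpha> \<and> \<alpha> \<longlonglongrightarrow> 1 \<and>
    (AE x in unit_leb. (\<lambda>n. F n x) \<longlonglongrightarrow> f x) \<and>
    tendsto_in_measure F f \<and>
    (SUP n. log_moment (\<alpha> n) (F n)) < \<infinity> \<and>
    \<not> (\<lambda>n. diff_entropy (F n)) \<longlonglongrightarrow> diff_entropy f"
proof -
  \<comment> \<open>The shift by 2 gives \<open>1 / m n \<le> 1 / 2\<close>, which keeps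
    \<open>b n\<close> away from 0.\<close>
  define m :: "nat \<Rightarrow> real" where "m n = real (n + 2)" for n
  \<comment> \<open>The width is the spike mass \<open>1 / m n\<close> divided by the height
    \<open>exp (m n)\<close>; \<open>b n\<close> then spreads the remaining mass over length
    \<open>1 - e n\<close>.\<close>
  define e where "e n = exp (- m n) / m n" for n
  define b where "b n = (1 - 1 / m n) / (1 - e n)" for n
  define F where "F n = step_fun (e n) (exp (m n)) (b n)" for n
  define \<alpha> where "\<alpha> n = 1 + 1 / m n" for n
  have m2: "2 \<le> m n" for n by (simp add: m_def)
  have e_pos: "0 < e n" and e_less: "e n < 1 / m n" for n
    using m2[of n] by (auto simp: e_def divide_strict_right_mono)
  have m_inv: "1 / m n \<le> 1 / 2" for n
    using m2[of n] by (simp add: field_simps)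
  have e1: "e n < 1" for n
    using e_less[of n] m_inv[of n] by simp
  have mass1: "e n * exp (m n) = 1 / m n" for n
    using m2[of n] by (simp add: e_def exp_minus field_simps)
  have mass2: "(1 - e n) * b n = 1 - 1 / m n" for n
    using e1[of n] by (simp add: b_def)
  have b_le: "b n \<le> 1" for n
    using e1[of n] e_less[of n] by (simp add: b_def)
  have b_ge: "1 / 2 \<le> b n" for n
    using e1[of n] e_pos[of n] m_inv[of n] by (simp add: b_def field_simps)
  have ln_b: "\<bar>ln (b n)\<bar> \<le> 1" for n
  proof -
    \<comment> \<open>Since \<open>b n \<le> 1\<close>, the absolute value of
      \<open>ln (b n)\<close> is \<open>ln (1 / b n)\<close>, and
      \<open>1 / b n \<le> 2\<close>.\<close>
    have "ln (1 / b n) \<le> 1 / b n - 1"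
      using b_ge[of n] by (intro ln_le_minus_one) auto
    also have "\<dots> \<le> 1" using b_ge[of n] by (simp add: field_simps)
    finally show ?thesis using b_ge[of n] b_le[of n] by (simp add: ln_div)
  qed
  have e_lim: "e \<longlonglongrightarrow> 0" unfolding e_def m_def by real_asymp
  have b_lim: "b \<longlonglongrightarrow> 1" unfolding b_def e_def m_def by real_asymp
  have \<alpha>_lim: "\<alpha> \<longlonglongrightarrow> 1" unfolding \<alpha>_def m_def by real_asymp
  have \<alpha>_gt: "1 < \<alpha> n" for n using m2[of n] by (simp add: \<alpha>_def)
  have \<alpha>_dec: "decseq \<alpha>" by (auto simp: decseq_def \<alpha>_def m_def field_simps)
  have uniform: "(\<lambda>_. 1) = step_fun 0 1 1" by (auto simp: step_fun_def)
  have F_pdf: "unit_pdf (F n)" for n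
    unfolding F_def using e_pos[of n] e1[of n] b_ge[of n] mass1[of n] mass2[of n]
    by (intro unit_pdf_step_fun) auto
  have f_pdf: "unit_pdf (\<lambda>_. 1)"
    unfolding uniform by (rule unit_pdf_step_fun) auto
  have f_entropy: "diff_entropy (\<lambda>_. 1) = 0"
    unfolding uniform by (subst diff_entropy_step_fun) auto
  \<comment> \<open>The point 0 lies in every spike, and \<open>F n 0 = exp (m n)\<close> diverges;
    it is the only exception in the unit interval.\<close>
  have "AE x in unit_leb. x \<noteq> (0::real)"
    by (auto simp: AE_restrict_space_iff intro: AE_mp[OF AE_lborel_singleton[THEN AE_completion]])
  then have F_AE: "AE x in unit_leb. (\<lambda>n. F n x) \<longlonglongrightarrow> 1"
    unfolding F_def by (rule AE_mp) (auto intro!: AE_I2 step_fun_tendsto e_lim b_lim)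
  have F_meas: "tendsto_in_measure F (\<lambda>_. 1)"
    unfolding F_def
    using e_pos e1 by (intro step_fun_tendsto_in_measure e_lim b_lim) (auto intro: less_imp_le)
  have moment: "log_moment (\<alpha> n) (F n) \<le> ennreal 3" for n
  proof -
    have spike: "e n * (exp (m n) * \<bar>ln (exp (m n))\<bar> powr \<alpha> n) \<le> 2"
    proof -
      have "e n * (exp (m n) * \<bar>ln (exp (m n))\<bar> powr \<alpha> n) = m n powr (1 / m n)"
        using m2[of n] mass1[of n]
        by (simp add: \<alpha>_def powr_add mult.assoc[symmetric])
      also have "\<dots> \<le> 2" unfolding m_def by (rule powr_inverse_le_2) simp
      finally show ?thesis .
    qed
    \<comment> \<open>The flat part contributes at most its own mass, hence at most 1; with the
      spike bound 2 this gives the constant 3.\<close>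
    have "\<bar>ln (b n)\<bar> powr \<alpha> n \<le> 1"
      using ln_b[of n] \<alpha>_gt[of n] by (intro powr_le1) auto
    then have "(1 - 1 / m n) * \<bar>ln (b n)\<bar> powr \<alpha> n \<le> 1"
      using m_inv[of n] m2[of n] by (intro mult_le_one) auto
    then have "(1 - e n) * (b n * \<bar>ln (b n)\<bar> powr \<alpha> n) \<le> 1"
      unfolding mult.assoc[symmetric] mass2 .
    with spike have "e n * (exp (m n) * \<bar>ln (exp (m n))\<bar> powr \<alpha> n) +
        (1 - e n) * (b n * \<bar>ln (b n)\<bar> powr \<alpha> n) \<le> 3"
      by linarith
    then show ?thesis
      unfolding F_def using e_pos[of n] e1[of n] b_ge[of n]
      by (subst log_moment_step_fun) (auto simp del: ln_exp ennreal_plus ennreal_numeral intro!: ennreal_leI)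
  qed
  have F_moment: "(SUP n. log_moment (\<alpha> n) (F n)) < \<infinity>"
    using moment by (intro le_less_trans[OF SUP_least]) auto
  \<comment> \<open>The summand 1 is the spike: mass \<open>1 / m n\<close> times
    \<open>ln (exp (m n)) = m n\<close>. The other term vanishes in the limit because
    \<open>b n\<close> tends to 1.\<close>
  have "diff_entropy (F n) = - (1 + (1 - 1 / m n) * ln (b n))" for n
    unfolding F_def using e_pos[of n] e1[of n] m2[of n]
    by (subst diff_entropy_step_fun) (auto simp: mult.assoc[symmetric] mass1 mass2)
  moreover have "(\<lambda>n. - (1 + (1 - 1 / m n) * ln (b n))) \<longlonglongrightarrow> - 1"
    unfolding b_def e_def m_def by real_asymp
  ultimately have "(\<lambda>n. diff_entropy (F n)) \<longlonglongrightarrow> - 1" by simp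
  then have "\<not> (\<lambda>n. diff_entropy (F n)) \<longlonglongrightarrow> diff_entropy (\<lambda>_. 1)"
    using LIMSEQ_unique f_entropy by fastforce
  moreover have "finite_entropy (\<lambda>_. 1)" by (simp add: finite_entropy_def)
  ultimately show ?thesis
    using F_pdf f_pdf \<alpha>_gt \<alpha>_dec \<alpha>_lim F_AE F_meas F_moment
    by (intro exI[of _ F] exI[of _ "\<lambda>_. 1"] exI[of _ \<alpha>]) blast
qed

end
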